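(* Let $\mathcal H$ be a Hilbert space and let $\{f_k\}_{k\in\mathbb Z}=\{T^kf_0\}_{k\in\mathbb Z}$ be an overcomplete frame for $\mathcal H$, with synthesis operator $U$ and kernel $N_U$ of $U$. If $T\in B(\mathcal H)$, then $\dim(N_U)=\infty$.
   Context: A sequence $\{f_k\}_{k\in\mathbb Z}$ is a frame for $\mathcal H$ if there are constants $A,B>0$ with $A\|f\|^2\le\sum_{k\in\mathbb Z}|\langle f,f_k\rangle|^2\le B\|f\|^2$ for all $f\in\mathcal H$; it is overcomplete if it is not a Riesz basis, equivalently if $N_U\ne\{0\}$. The synthesis operator is the bounded operator $U:\ell^2(\mathbb Z)\to\mathcal H$, $U\{c_k\}_{k\in\mathbb Z}=\sum_{k\in\mathbb Z}c_kf_k$, and $N_U=\{c\in\ell^2(\mathbb Z):Uc=0\}$. Writing $\{f_k\}_{k\in\mathbb Z}=\{T^kf_0\}_{k\in\mathbb Z}$ means that $T$ is a linear operator that restricts to a bijection of $\operatorname{span}\{f_k\}_{k\in\mathbb Z}$ (finite linear combinations) onto itself and $f_k=T^kf_0$ for all $k\in\mathbb Z$, where for $k<0$, $T^k:=(T^{-1})^{-k}$ with $T^{-1}$ the inverse of $T$ on the span. $T\in B(\mathcal H)$ means that $T$ is (or extends to) a bounded linear operator on $\mathcal H$; the bounded operator on $\mathcal H$ need not be injective. *)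

theory Defs
  imports "HOL-Analysis.Analysis" "HOL-Library.Function_Algebras"
begin

text \<open>Complex Hilbert spaces. The inner product is linear in the first argument.
  Positive definiteness is contained in \<open>norm_sq_cinner\<close>, because \<open>norm\<close> is a norm.\<close>

class complex_hilbert_space = banach +
  fixes scaleC :: "complex \<Rightarrow> 'a \<Rightarrow> 'a"  (infixr \<open>*\<^sub>C\<close> 75)
    and cinner :: "'a \<Rightarrow> 'a \<Rightarrow> complex"
  assumes scaleC_add_right: "a *\<^sub>C (x + y) = a *\<^sub>C x + a *\<^sub>C y"
    and scaleC_add_left: "(a + b) *\<^sub>C x = a *\<^sub>C x + b *\<^sub>C x"
    and scaleC_scaleC: "a *\<^sub>C b *\<^sub>C x = (a * b) *\<^sub>C x"
    and scaleR_scaleC: "r *\<^sub>R x = complex_of_real r *\<^sub>C x"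
    and cinner_commute: "cinner x y = cnj (cinner y x)"
    and cinner_add_left: "cinner (x + y) z = cinner x z + cinner y z"
    and cinner_scaleC_left: "cinner (a *\<^sub>C x) y = a * cinner x y"
    and norm_sq_cinner: "complex_of_real ((norm x)\<^sup>2) = cinner x x"

instantiation complex :: complex_hilbert_space
begin

definition scaleC_complex :: "complex \<Rightarrow> complex \<Rightarrow> complex" where
  "scaleC_complex a x = a * x"

definition cinner_complex :: "complex \<Rightarrow> complex \<Rightarrow> complex" where
  "cinner_complex x y = x * cnj y"

instance
  by standard
    (auto simp: scaleC_complex_def cinner_complex_def algebra_simps scaleR_conv_of_real
       complex_norm_square simp del: of_real_power)

end

global_interpretation complex_vector:
  vector_space "scaleC :: complex \<Rightarrow> 'a \<Rightarrow> 'a::complex_hilbert_space"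
proof
  show "1 *\<^sub>C x = x" for x :: 'a
    using scaleR_scaleC[of 1 x] by simp
qed (simp_all add: scaleC_add_right scaleC_add_left scaleC_scaleC)

global_interpretation complex_seq:
  vector_space "\<lambda>(a::complex) (c::int \<Rightarrow> complex) k. a * c k"
  by standard (auto simp: fun_eq_iff algebra_simps)

definition is_frame :: "(int \<Rightarrow> 'a::complex_hilbert_space) \<Rightarrow> bool" where
  "is_frame f \<longleftrightarrow> (\<exists>A>0. \<exists>B>0. \<forall>g.
     (\<lambda>k. (cmod (cinner g (f k)))\<^sup>2) summable_on UNIV \<and>
     A * (norm g)\<^sup>2 \<le> (\<Sum>\<^sub>\<infinity>k. (cmod (cinner g (f k)))\<^sup>2) \<and>
     (\<Sum>\<^sub>\<infinity>k. (cmod (cinner g (f k)))\<^sup>2) \<le> B * (norm g)\<^sup>2)"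

definition riesz_basis :: "(int \<Rightarrow> 'a::complex_hilbert_space) \<Rightarrow> bool" where
  "riesz_basis f \<longleftrightarrow> closure (complex_vector.span (range f)) = UNIV \<and>
     (\<exists>A>0. \<exists>B>0. \<forall>(c::int \<Rightarrow> complex) F. finite F \<longrightarrow>
        A * (\<Sum>k\<in>F. (cmod (c k))\<^sup>2) \<le> (norm (\<Sum>k\<in>F. c k *\<^sub>C f k))\<^sup>2 \<and>
        (norm (\<Sum>k\<in>F. c k *\<^sub>C f k))\<^sup>2 \<le> B * (\<Sum>k\<in>F. (cmod (c k))\<^sup>2))"

definition overcomplete_frame :: "(int \<Rightarrow> 'a::complex_hilbert_space) \<Rightarrow> bool" where
  "overcomplete_frame f \<longleftrightarrow> is_frame f \<and> \<not> riesz_basis f"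

definition ell2 :: "(int \<Rightarrow> complex) set" where
  "ell2 = {c. (\<lambda>k. (cmod (c k))\<^sup>2) summable_on UNIV}"

text \<open>For a frame \<open>f\<close> the series converges unconditionally for every \<open>c\<close> in \<open>ell2\<close>;
  only such \<open>c\<close> are considered in the kernel.\<close>

definition synthesis :: "(int \<Rightarrow> 'a::complex_hilbert_space) \<Rightarrow> (int \<Rightarrow> complex) \<Rightarrow> 'a" where
  "synthesis f c = (\<Sum>\<^sub>\<infinity>k. c k *\<^sub>C f k)"

definition synthesis_kernel :: "(int \<Rightarrow> 'a::complex_hilbert_space) \<Rightarrow> (int \<Rightarrow> complex) set" where
  "synthesis_kernel f = {c \<in> ell2. synthesis f c = 0}"

text \<open>The library's \<open>dim\<close> is natural-valued and so cannot express infinite dimension.\<close>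

definition infinite_dimensional :: "(int \<Rightarrow> complex) set \<Rightarrow> bool" where
  "infinite_dimensional V \<longleftrightarrow>
     (\<exists>B. B \<subseteq> V \<and> \<not> complex_seq.dependent B \<and> V \<subseteq> complex_seq.span B \<and> infinite B)"

text \<open>The relation \<open>f k = T\<^sup>k (f 0)\<close> for all integers \<open>k\<close>. Only the values of \<open>T\<close> on the span
  of the sequence matter; negative powers are powers of the inverse of \<open>T\<close> on that span.\<close>

definition represented_by ::
    "(int \<Rightarrow> 'a::complex_hilbert_space) \<Rightarrow> ('a \<Rightarrow> 'a) \<Rightarrow> bool" where
  "represented_by f T \<longleftrightarrow>
     (let V = complex_vector.span (range f) in
       (\<forall>x\<in>V. \<forall>y\<in>V. T (x + y) = T x + T y) \<and>
       (\<forall>a. \<forall>x\<in>V. T (a *\<^sub>C x) = a *\<^sub>C T x) \<and>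
       bij_betw T V V \<and>
       (\<forall>k. f k = (if k \<ge> 0 then (T ^^ nat k) (f 0)
                   else (inv_into V T ^^ nat (- k)) (f 0))))"

definition bounded_clinear :: "('a::complex_hilbert_space \<Rightarrow> 'a) \<Rightarrow> bool" where
  "bounded_clinear S \<longleftrightarrow> bounded_linear S \<and> (\<forall>a x. S (a *\<^sub>C x) = a *\<^sub>C S x)"

definition extends_to_bounded :: "'a::complex_hilbert_space set \<Rightarrow> ('a \<Rightarrow> 'a) \<Rightarrow> bool" where
  "extends_to_bounded V T \<longleftrightarrow> (\<exists>S. bounded_clinear S \<and> (\<forall>x\<in>V. S x = T x))"

end

theory Submission
  imports Defs "HOL-Computational_Algebra.Fundamental_Theorem_Algebra"
begin

text \<open>Since \<open>T\<close> is bounded, applying it termwise to \<open>\<Sum> c\<^sub>k f\<^sub>k = 0\<close> shows that the kernel of the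
  synthesis operator is invariant under the right shift of \<open>\<ell>\<^sup>2(\<int>)\<close>. The shift has no eigenvector
  in \<open>\<ell>\<^sup>2(\<int>)\<close>, so by factoring polynomials over \<open>\<complex>\<close> the shifts of a nonzero \<open>c\<close> are linearly
  independent. A nonzero \<open>c\<close> in the kernel exists because a frame with injective synthesis
  operator is a Riesz basis.\<close>

section \<open>Inner product identities and the Cauchy-Schwarz inequality\<close>

lemma cinner_add_right:
  fixes x y z :: "'a::complex_hilbert_space"
  shows "cinner x (y + z) = cinner x y + cinner x z"
  by (metis cinner_add_left cinner_commute complex_cnj_add)

lemma cinner_scaleC_right:
  fixes x y :: "'a::complex_hilbert_space"
  shows "cinner x (a *\<^sub>C y) = cnj a * cinner x y"
  by (metis cinner_commute cinner_scaleC_left complex_cnj_mult)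

lemma cinner_diff_left:
  fixes x y z :: "'a::complex_hilbert_space"
  shows "cinner (x - y) z = cinner x z - cinner y z"
  using cinner_add_left[of "x - y" y z] by simp

lemma cinner_zero_left [simp]: "cinner (0::'a::complex_hilbert_space) x = 0"
  using cinner_diff_left[of 0 0 x] by simp

lemma cinner_sum_left:
  fixes x :: "'b \<Rightarrow> 'a::complex_hilbert_space"
  shows "cinner (\<Sum>k\<in>F. x k) y = (\<Sum>k\<in>F. cinner (x k) y)"
  by (induction F rule: infinite_finite_induct) (auto simp: cinner_add_left)

lemma norm_sq_eq_Re_cinner:
  fixes x :: "'a::complex_hilbert_space"
  shows "(norm x)\<^sup>2 = Re (cinner x x)"
  by (metis norm_sq_cinner Re_complex_of_real)

lemma Re_cinner_commute:
  fixes x y :: "'a::complex_hilbert_space"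
  shows "Re (cinner x y) = Re (cinner y x)"
  by (metis cinner_commute cnj.sel(1))

lemma norm_add_sq:
  fixes x y :: "'a::complex_hilbert_space"
  shows "(norm (x + y))\<^sup>2 = (norm x)\<^sup>2 + 2 * Re (cinner x y) + (norm y)\<^sup>2"
  using Re_cinner_commute[of x y]
  by (simp add: norm_sq_eq_Re_cinner cinner_add_left cinner_add_right)

lemma Re_cinner_scaleR_left:
  fixes x y :: "'a::complex_hilbert_space"
  shows "Re (cinner (r *\<^sub>R x) y) = r * Re (cinner x y)"
  by (simp add: scaleR_scaleC cinner_scaleC_left)

lemma Re_cinner_scaleR_right:
  fixes x y :: "'a::complex_hilbert_space"
  shows "Re (cinner x (r *\<^sub>R y)) = r * Re (cinner x y)"
  by (simp add: scaleR_scaleC cinner_scaleC_right)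

lemma Re_cinner_le:
  fixes x y :: "'a::complex_hilbert_space"
  shows "\<bar>Re (cinner x y)\<bar> \<le> norm x * norm y"
proof (cases "y = 0")
  case True
  then show ?thesis
    using Re_cinner_commute[of x y] by simp
next
  case False
  define r where "r = Re (cinner x y)"
  \<comment> \<open>The vector is the component of x orthogonal to y for the real inner product,
    multiplied by the squared norm of y to avoid a division.\<close>
  have "0 \<le> (norm ((norm y)\<^sup>2 *\<^sub>R x + (- r) *\<^sub>R y))\<^sup>2"
    by simp
  also have "\<dots> = (norm y)\<^sup>2 * ((norm x * norm y)\<^sup>2 - r\<^sup>2)"
    unfolding norm_add_sq Re_cinner_scaleR_left Re_cinner_scaleR_right r_def [symmetric]
    by (simp add: power2_eq_square algebra_simps)
  finally have "r\<^sup>2 \<le> (norm x * norm y)\<^sup>2"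
    using False by (simp add: zero_le_mult_iff)
  then show ?thesis
    unfolding r_def abs_le_square_iff[symmetric] by simp
qed

lemma bounded_linear_Re_cinner:
  fixes y :: "'a::complex_hilbert_space"
  shows "bounded_linear (\<lambda>x. Re (cinner x y))"
  by (rule bounded_linear_intro[where K = "norm y"])
    (auto simp: cinner_add_left Re_cinner_scaleR_left Re_cinner_le)

section \<open>Unconditional summability in Banach spaces\<close>

text \<open>Cauchy criterion: sums over finite sets containing F differ from the sum over F only by
  a sum disjoint from F, so they form a Cauchy filter, which converges by completeness.\<close>

lemma norm_sum_le_imp_summable_on:
  fixes g :: "'b \<Rightarrow> 'a::banach"
  assumes "\<And>e. e > 0 \<Longrightarrow>
    \<exists>F. finite F \<and> F \<subseteq> A \<and> (\<forall>G. finite G \<longrightarrow> G \<subseteq> A \<longrightarrow> G \<inter> F = {} \<longrightarrow> norm (sum g G) < e)"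
  shows "g summable_on A"
proof -
  have "\<exists>P. eventually P (finite_subsets_at_top A) \<and>
      (\<forall>G H. P G \<and> P H \<longrightarrow> dist (sum g G) (sum g H) < e)" if "e > 0" for e :: real
  proof -
    obtain F where F: "finite F" "F \<subseteq> A"
      "\<And>G. finite G \<Longrightarrow> G \<subseteq> A \<Longrightarrow> G \<inter> F = {} \<Longrightarrow> norm (sum g G) < e / 2"
      using assms[of "e / 2"] \<open>e > 0\<close> by auto
    let ?P = "\<lambda>G. finite G \<and> F \<subseteq> G \<and> G \<subseteq> A"
    have near: "dist (sum g G) (sum g F) < e / 2" if "?P G" for G
    proof -
      have "sum g G - sum g F = sum g (G - F)"
        using that by (simp add: sum_diff)
      then show ?thesis
        using F(3)[of "G - F"] that by (auto simp: dist_norm)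
    qed
    have "eventually ?P (finite_subsets_at_top A)"
      using F(1,2) by (auto simp: eventually_finite_subsets_at_top)
    moreover have "dist (sum g G) (sum g H) < e" if "?P G" "?P H" for G H
      using near[OF that(1)] near[OF that(2)] dist_triangle_half_l by blast
    ultimately show ?thesis
      by (intro exI[of _ ?P]) simp
  qed
  then have "cauchy_filter (filtermap (sum g) (finite_subsets_at_top A))"
    by (simp add: cauchy_filter_metric_filtermap)
  then obtain l where "(sum g \<longlongrightarrow> l) (finite_subsets_at_top A)"
    using cauchy_filter_complete_converges[of "filtermap (sum g) (finite_subsets_at_top A)" UNIV]
      complete_UNIV
    by (auto simp: filterlim_def filtermap_bot_iff)
  then show ?thesis
    by (auto simp: summable_on_def has_sum_def)
qed

section \<open>The sequence space and its right shift\<close>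

lemma ell2_diff:
  assumes "c \<in> ell2" "d \<in> ell2"
  shows "(\<lambda>k. c k - d k) \<in> ell2"
proof -
  have "(\<lambda>k. 2 * (cmod (c k))\<^sup>2 + 2 * (cmod (d k))\<^sup>2) summable_on UNIV"
    using assms by (intro summable_on_add summable_on_cmult_right) (auto simp: ell2_def)
  then show ?thesis
    unfolding ell2_def mem_Collect_eq
  proof (rule summable_on_comparison_test)
    fix k
    have "(cmod (c k - d k))\<^sup>2 \<le> (cmod (c k) + cmod (d k))\<^sup>2"
      by (intro power_mono norm_triangle_ineq4) auto
    also have "\<dots> \<le> 2 * (cmod (c k))\<^sup>2 + 2 * (cmod (d k))\<^sup>2"
      using sum_squares_bound[of "cmod (c k)" "cmod (d k)"] by (simp add: power2_sum)
    finally show "(cmod (c k - d k))\<^sup>2 \<le> 2 * (cmod (c k))\<^sup>2 + 2 * (cmod (d k))\<^sup>2" .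
  qed auto
qed

lemma ell2_cmult: "c \<in> ell2 \<Longrightarrow> (\<lambda>k. a * c k) \<in> ell2"
  by (auto simp: ell2_def norm_mult power_mult_distrib intro!: summable_on_cmult_right)

lemma ell2_zero: "(\<lambda>k. 0) \<in> ell2"
  by (simp add: ell2_def)

lemma ell2_add: "c \<in> ell2 \<Longrightarrow> d \<in> ell2 \<Longrightarrow> (\<lambda>k. c k + d k) \<in> ell2"
  using ell2_diff[of c "\<lambda>k. (-1) * d k"] ell2_cmult[of d "-1"] by simp

lemma bij_int_pred: "bij_betw (\<lambda>k::int. k - 1) UNIV UNIV"
  by (rule bij_betwI[where g = "\<lambda>k. k + 1"]) auto

lemma ell2_shift:
  assumes "c \<in> ell2"
  shows "(\<lambda>k. c (k - 1)) \<in> ell2"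
  using assms summable_on_reindex_bij_betw[OF bij_int_pred, of "\<lambda>k. (cmod (c k))\<^sup>2"]
  by (simp add: ell2_def)

text \<open>The shift is an isometry, so a nonzero g forces z to have modulus 1. Then the modulus of
  \<open>g k\<close> is constant in k, and a nonzero constant is not square-summable over the
  integers.\<close>

lemma ell2_shift_no_eigenvector:
  assumes "g \<in> ell2" and eig: "\<And>k. g (k - 1) = z * g k"
  shows "g = (\<lambda>k. 0)"
proof (rule ccontr)
  let ?s = "\<Sum>\<^sub>\<infinity>k. (cmod (g k))\<^sup>2"
  assume "g \<noteq> (\<lambda>k. 0)"
  then obtain m where m: "g m \<noteq> 0"
    by auto
  have sum: "(\<lambda>k. (cmod (g k))\<^sup>2) summable_on UNIV"
    using assms(1) by (simp add: ell2_def)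
  have "?s = (\<Sum>\<^sub>\<infinity>k. (cmod (g (k - 1)))\<^sup>2)"
    by (rule infsum_reindex_bij_betw[OF bij_int_pred, symmetric])
  also have "\<dots> = (cmod z)\<^sup>2 * ?s"
    by (simp add: eig norm_mult power_mult_distrib infsum_cmult_right')
  finally have "?s = (cmod z)\<^sup>2 * ?s" .
  moreover have "?s > 0"
    using finite_sum_le_infsum[OF sum, of "{m}"] m
    by (simp add: less_le_trans[of 0 "(cmod (g m))\<^sup>2"])
  ultimately have "(cmod z)\<^sup>2 = 1"
    by simp
  then have step: "cmod (g (k - 1)) = cmod (g k)" for k
    by (simp add: eig norm_mult power2_eq_1_iff) (smt (verit) norm_ge_zero)
  define r where "r = cmod (g m)"
  have const: "cmod (g k) = r" for k
  proof (induction k rule: int_induct[of _ m])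
    case (step1 i)
    then show ?case using step[of "i + 1"] by simp
  next
    case (step2 i)
    then show ?case using step[of i] by simp
  qed (simp add: r_def)
  have "(\<lambda>k::int. r\<^sup>2) summable_on UNIV"
    using sum by (simp add: const)
  moreover have "r\<^sup>2 \<noteq> 0"
    using m by (simp add: r_def)
  ultimately show False
    using infsum_diverge_constant[OF infinite_UNIV_int] by blast
qed

section \<open>Polynomials in the shift and independence of the shifts\<close>

lemma sum_fun_apply: "(\<Sum>i\<in>I. g i) x = (\<Sum>i\<in>I. g i x)"
  by (induction I rule: infinite_finite_induct) auto

text \<open>\<open>shift_poly p c\<close> is \<open>p(R) c\<close>, where \<open>(R c) k = c (k - 1)\<close> is the right shift.\<close>

definition shift_poly :: "complex poly \<Rightarrow> (int \<Rightarrow> complex) \<Rightarrow> int \<Rightarrow> complex" where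
  "shift_poly p c k = (\<Sum>j\<le>degree p. coeff p j * c (k - int j))"

text \<open>Coefficients beyond the degree vanish, so polynomials of different degrees can be
  expanded over a common range.\<close>

lemma shift_poly_altdef:
  assumes "degree p \<le> n"
  shows "shift_poly p c k = (\<Sum>j\<le>n. coeff p j * c (k - int j))"
  unfolding shift_poly_def using assms
  by (intro sum.mono_neutral_left) (auto simp: coeff_eq_0)

lemma shift_poly_pCons: "shift_poly (pCons a p) c k = a * c k + shift_poly p c (k - 1)"
  by (subst shift_poly_altdef[of _ "Suc (degree p)"])
    (auto simp: degree_pCons_le sum.atMost_Suc_shift shift_poly_def algebra_simps
      simp del: sum.atMost_Suc)

lemma shift_poly_add: "shift_poly (p + q) c k = shift_poly p c k + shift_poly q c k"
  by (simp add: shift_poly_altdef[of _ "max (degree p) (degree q)"] degree_add_le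
      algebra_simps sum.distrib)

lemma shift_poly_smult: "shift_poly (smult a p) c k = a * shift_poly p c k"
  by (simp add: shift_poly_altdef[of _ "degree p"] degree_smult_le sum_distrib_left mult.assoc)

lemma shift_poly_0 [simp]: "shift_poly 0 c k = 0"
  by (simp add: shift_poly_def)

lemma shift_poly_sum: "shift_poly (\<Sum>i\<in>I. p i) c k = (\<Sum>i\<in>I. shift_poly (p i) c k)"
  by (induction I rule: infinite_finite_induct) (auto simp: shift_poly_add)

lemma shift_poly_monom: "shift_poly (monom a n) c k = a * c (k - int n)"
  by (induction n arbitrary: k)
    (auto simp: monom_0 monom_Suc shift_poly_pCons algebra_simps)

lemma shift_poly_ell2:
  assumes "c \<in> ell2"
  shows "shift_poly p c \<in> ell2"
proof (induction p)
  case 0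
  then show ?case using ell2_zero by (simp add: shift_poly_def)
next
  case (pCons a p)
  have "shift_poly (pCons a p) c = (\<lambda>k. a * c k + shift_poly p c (k - 1))"
    by (simp add: shift_poly_pCons fun_eq_iff)
  then show ?case
    using ell2_add[OF ell2_cmult[OF assms] ell2_shift[OF pCons.IH]] by simp
qed

text \<open>Induction on the degree: a root z gives p = (X - z) q, so the shift multiplies
  \<open>shift_poly q c\<close> by z. This sequence lies in \<open>ell2\<close>, hence vanishes, and
  the induction hypothesis applies to q.\<close>

lemma shift_poly_eq_0D:
  assumes "c \<in> ell2" "p \<noteq> 0" "shift_poly p c = (\<lambda>k. 0)"
  shows "c = (\<lambda>k. 0)"
  using assms(2,3)
proof (induction "degree p" arbitrary: p)
  case 0
  then obtain a where "p = [:a:]" "a \<noteq> 0"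
    by (metis degree_eq_zeroE pCons_0_0)
  then show ?case
    using 0 by (simp add: fun_eq_iff shift_poly_pCons)
next
  case (Suc n)
  then obtain z where "poly p z = 0"
    using alg_closed_imp_poly_has_root[of p] by auto
  then obtain q where q: "p = [:- z, 1:] * q"
    by (auto simp: poly_eq_0_iff_dvd)
  then have "q \<noteq> 0"
    using Suc.prems by auto
  then have "degree p = Suc (degree q)"
    unfolding q by (subst degree_mult_eq) auto
  have p: "p = smult (- z) q + pCons 0 q"
    by (simp add: q)
  have "shift_poly q c (k - 1) = z * shift_poly q c k" for k
  proof -
    have "shift_poly p c k = - z * shift_poly q c k + shift_poly q c (k - 1)"
      by (simp only: p shift_poly_add shift_poly_smult shift_poly_pCons) simp
    then show ?thesis
      using Suc.prems(2) by simp
  qed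
  then have "shift_poly q c = (\<lambda>k. 0)"
    using ell2_shift_no_eigenvector[OF shift_poly_ell2[OF assms(1)]] by blast
  then show ?case
    using Suc.hyps \<open>degree p = Suc (degree q)\<close> \<open>q \<noteq> 0\<close> by simp
qed

text \<open>A linear relation among the shifts of c says that \<open>shift_poly p c\<close>
  vanishes, where p carries the coefficients of the relation; hence p is zero. Injectivity is the
  case of the relation between two equal shifts.\<close>

lemma
  assumes "c \<in> ell2" "c \<noteq> (\<lambda>k. 0)"
  shows inj_ell2_shifts: "inj (\<lambda>(j::nat) k. c (k - int j))"
    and independent_ell2_shifts: "\<not> complex_seq.dependent (range (\<lambda>(j::nat) k. c (k - int j)))"
proof -
  let ?r = "\<lambda>(j::nat) k. c (k - int j)"
  show inj: "inj ?r"
  proof (rule injI)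
    fix i j :: nat
    assume "?r i = ?r j"
    then have "shift_poly (monom 1 i + monom (- 1) j) c = (\<lambda>k. 0)"
      by (simp add: fun_eq_iff shift_poly_add shift_poly_monom)
    then have "monom 1 i + monom (- 1 :: complex) j = 0"
      using shift_poly_eq_0D[OF assms(1)] assms(2) by blast
    then have "coeff (monom 1 i + monom (- 1 :: complex) j) i = 0"
      by simp
    then show "i = j"
      by (simp split: if_splits)
  qed
  show "\<not> complex_seq.dependent (range ?r)"
  proof
    assume "complex_seq.dependent (range ?r)"
    then obtain t u where t: "finite t" "t \<subseteq> range ?r"
      and zero: "(\<Sum>v\<in>t. (\<lambda>k. u v * v k)) = 0" and "\<exists>v\<in>t. u v \<noteq> 0"
      unfolding complex_seq.dependent_explicit by auto
    \<comment> \<open>The relation is indexed by sequences; passing to J indexes it by exponents,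
      and injectivity ensures that no two exponents share a sequence.\<close>
    moreover obtain J where J: "finite J" "t = ?r ` J"
      using finite_subset_image[OF t] by blast
    ultimately obtain j where j: "j \<in> J" "u (?r j) \<noteq> 0"
      by auto
    define p where "p = (\<Sum>i\<in>J. monom (u (?r i)) i)"
    have "shift_poly p c k = (\<Sum>v\<in>t. (\<lambda>k. u v * v k)) k" for k
      unfolding p_def shift_poly_sum shift_poly_monom J(2)
      by (subst sum.reindex) (use inj inj_on_subset in \<open>auto simp: sum_fun_apply\<close>)
    then have "shift_poly p c = (\<lambda>k. 0)"
      using zero by (simp add: fun_eq_iff)
    then have "p = 0"
      using shift_poly_eq_0D[OF assms(1)] assms(2) by blast
    moreover have "coeff p j = u (?r j)"
      using J(1) j(1) by (simp add: p_def coeff_sum)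
    ultimately show False
      using j(2) by simp
  qed
qed

section \<open>Convergence and boundedness of the synthesis operator\<close>

locale hilbert_frame =
  fixes f :: "int \<Rightarrow> 'a::complex_hilbert_space" and A B :: real
  assumes A_pos: "A > 0" and B_pos: "B > 0"
    and coeffs_summable: "\<And>g. (\<lambda>k. (cmod (cinner g (f k)))\<^sup>2) summable_on UNIV"
    and lower: "\<And>g. A * (norm g)\<^sup>2 \<le> (\<Sum>\<^sub>\<infinity>k. (cmod (cinner g (f k)))\<^sup>2)"
    and upper: "\<And>g. (\<Sum>\<^sub>\<infinity>k. (cmod (cinner g (f k)))\<^sup>2) \<le> B * (norm g)\<^sup>2"
begin

lemma coeffs_ell2: "(\<lambda>k. cinner g (f k)) \<in> ell2"
  using coeffs_summable by (simp add: ell2_def)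

text \<open>Duality: the finite sum h is paired with itself, Cauchy-Schwarz is applied to the sum
  over F, and the coefficients of h are bounded by the upper frame inequality. One factor
  \<open>(norm h)\<^sup>2\<close> then cancels.\<close>

lemma norm_finite_synthesis_le:
  assumes "finite F"
  shows "(norm (\<Sum>k\<in>F. c k *\<^sub>C f k))\<^sup>2 \<le> B * (\<Sum>k\<in>F. (cmod (c k))\<^sup>2)"
proof -
  define h where "h = (\<Sum>k\<in>F. c k *\<^sub>C f k)"
  define X where "X = (\<Sum>k\<in>F. (cmod (c k))\<^sup>2)"
  define Y where "Y = (\<Sum>k\<in>F. (cmod (cinner h (f k)))\<^sup>2)"
  have "X \<ge> 0" "Y \<ge> 0"
    by (auto simp: X_def Y_def intro: sum_nonneg)
  have "(norm h)\<^sup>2 = Re (cinner h h)"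
    by (rule norm_sq_eq_Re_cinner)
  also have "\<dots> \<le> cmod (cinner h h)"
    by (rule complex_Re_le_cmod)
  also have "cinner h h = (\<Sum>k\<in>F. c k * cinner (f k) h)"
    by (subst (1) h_def) (simp add: cinner_sum_left cinner_scaleC_left)
  also have "cmod \<dots> \<le> (\<Sum>k\<in>F. cmod (c k * cinner (f k) h))"
    by (rule norm_sum)
  also have "\<dots> = (\<Sum>k\<in>F. \<bar>cmod (c k)\<bar> * \<bar>cmod (cinner h (f k))\<bar>)"
    by (intro sum.cong) (simp_all add: norm_mult cinner_commute[of h])
  also have "\<dots> \<le> sqrt X * sqrt Y"
    using L2_set_mult_ineq[of "\<lambda>k. cmod (c k)" "\<lambda>k. cmod (cinner h (f k))" F]
    by (simp add: L2_set_def X_def Y_def)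
  finally have "((norm h)\<^sup>2)\<^sup>2 \<le> (sqrt X * sqrt Y)\<^sup>2"
    by (intro power_mono) auto
  also have "\<dots> = X * Y"
    using \<open>X \<ge> 0\<close> \<open>Y \<ge> 0\<close> by (simp add: power_mult_distrib)
  also have "Y \<le> B * (norm h)\<^sup>2"
    unfolding Y_def
    using finite_sum_le_infsum[OF coeffs_summable[of h] assms] upper[of h] by simp
  finally have "((norm h)\<^sup>2)\<^sup>2 \<le> X * (B * (norm h)\<^sup>2)"
    using \<open>X \<ge> 0\<close> by (simp add: mult_left_mono)
  then have "(norm h)\<^sup>2 * (norm h)\<^sup>2 \<le> (B * X) * (norm h)\<^sup>2"
    by (simp add: power2_eq_square algebra_simps)
  then have "(norm h)\<^sup>2 \<le> B * X"
    using B_pos \<open>X \<ge> 0\<close> mult_right_le_imp_le[of "(norm h)\<^sup>2" "(norm h)\<^sup>2" "B * X"]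
    by (cases "h = 0") auto
  then show ?thesis
    by (simp add: h_def X_def)
qed

text \<open>Tails of the series are small by \<open>norm_finite_synthesis_le\<close>. Since
  \<open>infsum\<close> is 0 for families that are not summable, only this convergence makes
  membership in \<open>synthesis_kernel\<close> a genuine statement about the series.\<close>

lemma synthesis_has_sum:
  assumes "c \<in> ell2"
  shows "((\<lambda>k. c k *\<^sub>C f k) has_sum synthesis f c) UNIV"
proof -
  let ?n = "\<lambda>k. (cmod (c k))\<^sup>2"
  have sum: "?n summable_on UNIV"
    using assms by (simp add: ell2_def)
  have "(\<lambda>k. c k *\<^sub>C f k) summable_on UNIV"
  proof (rule norm_sum_le_imp_summable_on)
    fix e :: real
    assume "e > 0"
    \<comment> \<open>The factor B turns this tolerance into half of \<open>e\<^sup>2\<close>, which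
      leaves room for a strict inequality.\<close>
    then obtain F where F: "finite F" "dist (sum ?n F) (infsum ?n UNIV) \<le> e\<^sup>2 / (2 * B)"
      using infsum_finite_approximation[OF sum, of "e\<^sup>2 / (2 * B)"] B_pos by auto
    have "norm (\<Sum>k\<in>G. c k *\<^sub>C f k) < e" if G: "finite G" "G \<inter> F = {}" for G
    proof -
      have "sum ?n F + sum ?n G \<le> infsum ?n UNIV"
        using finite_sum_le_infsum[OF sum, of "F \<union> G"] G F(1)
        by (simp add: sum.union_disjoint Int_commute)
      then have "sum ?n G \<le> e\<^sup>2 / (2 * B)"
        using F(2) by (simp add: dist_real_def)
      then have "B * sum ?n G \<le> e\<^sup>2 / 2"
        using B_pos by (simp add: field_simps)
      then have "(norm (\<Sum>k\<in>G. c k *\<^sub>C f k))\<^sup>2 \<le> e\<^sup>2 / 2"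
        using norm_finite_synthesis_le[OF G(1), of c] by simp
      also have "\<dots> < e\<^sup>2"
        using \<open>e > 0\<close> by simp
      finally show ?thesis
        using \<open>e > 0\<close> by (simp add: power_less_imp_less_base)
    qed
    with F(1) show "\<exists>F. finite F \<and> F \<subseteq> UNIV \<and> (\<forall>G. finite G \<longrightarrow> G \<subseteq> UNIV \<longrightarrow>
        G \<inter> F = {} \<longrightarrow> norm (\<Sum>k\<in>G. c k *\<^sub>C f k) < e)"
      by blast
  qed
  then show ?thesis
    by (simp add: synthesis_def)
qed

lemma norm_synthesis_le:
  assumes "c \<in> ell2"
  shows "(norm (synthesis f c))\<^sup>2 \<le> B * (\<Sum>\<^sub>\<infinity>k. (cmod (c k))\<^sup>2)"
proof (rule tendsto_upperbound)
  show "((\<lambda>F. (norm (\<Sum>k\<in>F. c k *\<^sub>C f k))\<^sup>2) \<longlongrightarrow> (norm (synthesis f c))\<^sup>2)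
      (finite_subsets_at_top UNIV)"
    using synthesis_has_sum[OF assms] unfolding has_sum_def by (intro tendsto_intros)
  have "(norm (\<Sum>k\<in>F. c k *\<^sub>C f k))\<^sup>2 \<le> B * (\<Sum>\<^sub>\<infinity>k. (cmod (c k))\<^sup>2)" if "finite F" for F
  proof -
    have "(\<Sum>k\<in>F. (cmod (c k))\<^sup>2) \<le> (\<Sum>\<^sub>\<infinity>k. (cmod (c k))\<^sup>2)"
      using assms that by (intro finite_sum_le_infsum) (auto simp: ell2_def)
    then show ?thesis
      using norm_finite_synthesis_le[OF that, of c] B_pos mult_left_mono
      by (smt (verit))
  qed
  then show "\<forall>\<^sub>F F in finite_subsets_at_top UNIV.
      (norm (\<Sum>k\<in>F. c k *\<^sub>C f k))\<^sup>2 \<le> B * (\<Sum>\<^sub>\<infinity>k. (cmod (c k))\<^sup>2)"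
    by (intro eventually_finite_subsets_at_top_weakI)
qed simp

lemma synthesis_diff:
  assumes "c \<in> ell2" "d \<in> ell2"
  shows "synthesis f (\<lambda>k. c k - d k) = synthesis f c - synthesis f d"
proof -
  have "((\<lambda>k. c k *\<^sub>C f k - d k *\<^sub>C f k) has_sum (synthesis f c - synthesis f d)) UNIV"
    using has_sum_add[OF synthesis_has_sum[OF assms(1)]
        has_sum_bounded_linear[OF bounded_linear_minus[OF bounded_linear_ident]
          synthesis_has_sum[OF assms(2)]]]
    by simp
  then show ?thesis
    unfolding synthesis_def by (simp only: complex_vector.scale_left_diff_distrib infsumI)
qed

section \<open>The frame operator and its surjectivity\<close>

text \<open>This is the synthesis operator composed with its adjoint, which sends g to its
  coefficients \<open>cinner g (f k)\<close>.\<close>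

abbreviation frame_operator :: "'a \<Rightarrow> 'a" where
  "frame_operator g \<equiv> synthesis f (\<lambda>k. cinner g (f k))"

lemma frame_operator_diff: "frame_operator (g - h) = frame_operator g - frame_operator h"
  using synthesis_diff[OF coeffs_ell2 coeffs_ell2] by (simp add: cinner_diff_left)

text \<open>The continuous functional \<open>\<lambda>x. Re (cinner x g)\<close> may be applied
  termwise. Together with \<open>lower\<close>, the identity makes the frame operator coercive with
  constant A.\<close>

lemma Re_cinner_frame_operator:
  "Re (cinner (frame_operator g) g) = (\<Sum>\<^sub>\<infinity>k. (cmod (cinner g (f k)))\<^sup>2)"
proof -
  have "((\<lambda>k. Re (cinner (cinner g (f k) *\<^sub>C f k) g)) has_sum Re (cinner (frame_operator g) g)) UNIV"
    by (rule has_sum_bounded_linear[OF bounded_linear_Re_cinner synthesis_has_sum[OF coeffs_ell2]])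
  moreover have "Re (cinner (cinner g (f k) *\<^sub>C f k) g) = (cmod (cinner g (f k)))\<^sup>2" for k
    unfolding cinner_scaleC_left cinner_commute[of "f k" g]
    by (metis complex_norm_square Re_complex_of_real)
  ultimately show ?thesis
    by (simp add: infsumI)
qed

lemma norm_frame_operator_le: "(norm (frame_operator g))\<^sup>2 \<le> B\<^sup>2 * (norm g)\<^sup>2"
proof -
  have "(norm (frame_operator g))\<^sup>2 \<le> B * (\<Sum>\<^sub>\<infinity>k. (cmod (cinner g (f k)))\<^sup>2)"
    by (rule norm_synthesis_le[OF coeffs_ell2])
  also have "\<dots> \<le> B * (B * (norm g)\<^sup>2)"
    using B_pos upper by (intro mult_left_mono) auto
  finally show ?thesis
    by (simp add: power2_eq_square mult.assoc)
qed

text \<open>With \<open>t = A / B\<^sup>2\<close>, the map \<open>g \<mapsto> g + t (h - S g)\<close> for the frame operator \<open>S\<close> is a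
  contraction, because \<open>\<parallel>x - t S x\<parallel>\<^sup>2 \<le> (1 - 2 t A + t\<^sup>2 B\<^sup>2) \<parallel>x\<parallel>\<^sup>2\<close>; its fixed point solves
  \<open>S g = h\<close>.\<close>

lemma surj_frame_operator: "\<exists>g. frame_operator g = h"
proof -
  define t where "t = A / B\<^sup>2"
  \<comment> \<open>The maximum keeps q nonnegative, so that \<open>sqrt q\<close> can serve as
    contraction constant: on the zero space the frame inequalities do not force A \<le> B.\<close>
  define q where "q = max 0 (1 - A\<^sup>2 / B\<^sup>2)"
  have "t > 0" and q: "q \<ge> 0" "q < 1"
    using A_pos B_pos by (auto simp: t_def q_def)
  have contr: "(norm (x - t *\<^sub>R frame_operator x))\<^sup>2 \<le> q * (norm x)\<^sup>2" for x
  proof -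
    let ?S = "frame_operator x"
    have "(norm (x - t *\<^sub>R ?S))\<^sup>2 = (norm (x + (- t) *\<^sub>R ?S))\<^sup>2"
      by simp
    also have "\<dots> = (norm x)\<^sup>2 - 2 * t * Re (cinner ?S x) + t\<^sup>2 * (norm ?S)\<^sup>2"
      unfolding norm_add_sq Re_cinner_scaleR_right
      by (simp add: Re_cinner_commute[of x] power_mult_distrib)
    also have "\<dots> \<le> (norm x)\<^sup>2 - 2 * t * (A * (norm x)\<^sup>2) + t\<^sup>2 * (B\<^sup>2 * (norm x)\<^sup>2)"
      using lower[of x] norm_frame_operator_le[of x] \<open>t > 0\<close>
      by (intro add_mono diff_mono mult_left_mono) (auto simp: Re_cinner_frame_operator)
    also have "\<dots> = (1 - A\<^sup>2 / B\<^sup>2) * (norm x)\<^sup>2"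
      using B_pos by (simp add: t_def field_simps power2_eq_square)
    also have "\<dots> \<le> q * (norm x)\<^sup>2"
      by (intro mult_right_mono) (auto simp: q_def)
    finally show ?thesis .
  qed
  let ?\<Phi> = "\<lambda>g. g + t *\<^sub>R (h - frame_operator g)"
  have "dist (?\<Phi> x) (?\<Phi> y) \<le> sqrt q * dist x y" for x y
  proof -
    have "?\<Phi> x - ?\<Phi> y = (x - y) - t *\<^sub>R frame_operator (x - y)"
      by (simp add: frame_operator_diff algebra_simps)
    then have "(dist (?\<Phi> x) (?\<Phi> y))\<^sup>2 \<le> q * (dist x y)\<^sup>2"
      unfolding dist_norm using contr[of "x - y"] by (simp only:)
    also have "\<dots> = (sqrt q * dist x y)\<^sup>2"
      using q(1) by (simp add: power_mult_distrib)
    finally have "(dist (?\<Phi> x) (?\<Phi> y))\<^sup>2 \<le> (sqrt q * dist x y)\<^sup>2" .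
    then show ?thesis
      by (rule power2_le_imp_le) (simp add: q(1))
  qed
  then obtain g where "?\<Phi> g = g"
    using banach_fix_type[of "sqrt q" ?\<Phi>] q by auto
  then show ?thesis
    using \<open>t > 0\<close> by auto
qed

section \<open>From a trivial kernel to a Riesz basis\<close>

text \<open>By surjectivity of the frame operator, every h is the sum of a series in the
  \<open>f k\<close>, hence a limit of finite combinations.\<close>

lemma closure_span_eq_UNIV: "closure (complex_vector.span (range f)) = UNIV"
proof -
  have "h \<in> closure (complex_vector.span (range f))" for h
  proof -
    obtain g where "frame_operator g = h"
      using surj_frame_operator by blast
    then have "((\<lambda>k. cinner g (f k) *\<^sub>C f k) has_sum h) UNIV"
      using synthesis_has_sum[OF coeffs_ell2] by metis
    then have lim: "((\<lambda>F. \<Sum>k\<in>F. cinner g (f k) *\<^sub>C f k) \<longlongrightarrow> h) (finite_subsets_at_top UNIV)"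
      by (simp add: has_sum_def)
    have "(\<Sum>k\<in>F. cinner g (f k) *\<^sub>C f k) \<in> closure (complex_vector.span (range f))" for F
      by (intro subsetD[OF closure_subset] complex_vector.span_sum complex_vector.span_scale
          complex_vector.span_base) auto
    then show ?thesis
      by (intro Lim_in_closed_set[OF closed_closure _ _ lim]) auto
  qed
  then show ?thesis
    by auto
qed

text \<open>If the synthesis operator \<open>U\<close> is injective, then every \<open>c\<close> equals \<open>U\<^sup>* g\<close> for a solution \<open>g\<close>
  of \<open>U U\<^sup>* g = U c\<close>, so that \<open>\<parallel>c\<parallel>\<^sup>2 = Re \<langle>U c, g\<rangle>\<close> with \<open>A \<parallel>g\<parallel>\<^sup>2 \<le> \<parallel>c\<parallel>\<^sup>2\<close>.\<close>

lemma norm_synthesis_ge: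
  assumes "synthesis_kernel f \<subseteq> {\<lambda>k. 0}" "c \<in> ell2"
  shows "A * (\<Sum>\<^sub>\<infinity>k. (cmod (c k))\<^sup>2) \<le> (norm (synthesis f c))\<^sup>2"
proof -
  obtain g where g: "frame_operator g = synthesis f c"
    using surj_frame_operator by blast
  have "(\<lambda>k. c k - cinner g (f k)) \<in> synthesis_kernel f"
    using g synthesis_diff[OF assms(2) coeffs_ell2] ell2_diff[OF assms(2) coeffs_ell2]
    by (simp add: synthesis_kernel_def)
  then have c: "c = (\<lambda>k. cinner g (f k))"
    using assms(1) by (force simp: fun_eq_iff)
  define X where "X = (\<Sum>\<^sub>\<infinity>k. (cmod (c k))\<^sup>2)"
  let ?h = "synthesis f c"
  have AX: "A * (norm g)\<^sup>2 \<le> X"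
    using lower[of g] by (simp add: X_def c)
  have "X = Re (cinner ?h g)"
    using Re_cinner_frame_operator[of g] by (simp add: X_def c)
  also have "\<dots> \<le> norm ?h * norm g"
    using Re_cinner_le[of ?h g] by simp
  finally have X: "X \<le> norm ?h * norm g" .
  have "X \<ge> 0"
    unfolding X_def by (intro infsum_nonneg) auto
  have "A * X * X \<le> A * (norm ?h * norm g)\<^sup>2"
    using power_mono[OF X \<open>X \<ge> 0\<close>, of 2] A_pos by (simp add: power2_eq_square)
  also have "\<dots> = (norm ?h)\<^sup>2 * (A * (norm g)\<^sup>2)"
    by (simp add: power_mult_distrib)
  also have "\<dots> \<le> (norm ?h)\<^sup>2 * X"
    using AX by (intro mult_left_mono) auto
  finally have "A * X \<le> (norm ?h)\<^sup>2"
    using \<open>X \<ge> 0\<close> by (cases "X = 0") (auto simp: mult_le_cancel_right)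
  then show ?thesis
    by (simp add: X_def)
qed

text \<open>Finite sequences, extended by zero, inherit the lower bound from
  \<open>norm_synthesis_ge\<close>. In contrapositive form, overcompleteness yields a nonzero kernel
  element.\<close>

lemma riesz_basis_if_kernel_trivial:
  assumes "synthesis_kernel f \<subseteq> {\<lambda>k. 0}"
  shows "riesz_basis f"
proof -
  have "A * (\<Sum>k\<in>F. (cmod (c k))\<^sup>2) \<le> (norm (\<Sum>k\<in>F. c k *\<^sub>C f k))\<^sup>2"
    if F: "finite F" for F and c :: "int \<Rightarrow> complex"
  proof -
    let ?c = "\<lambda>k. if k \<in> F then c k else 0"
    have sq: "((\<lambda>k. (cmod (?c k))\<^sup>2) has_sum (\<Sum>k\<in>F. (cmod (c k))\<^sup>2)) UNIV"
      using has_sum_finite[OF F, of "\<lambda>k. (cmod (c k))\<^sup>2"]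
      by (rule has_sum_cong_neutral[THEN iffD1, rotated -1]) auto
    have syn: "((\<lambda>k. ?c k *\<^sub>C f k) has_sum (\<Sum>k\<in>F. c k *\<^sub>C f k)) UNIV"
      using has_sum_finite[OF F, of "\<lambda>k. c k *\<^sub>C f k"]
      by (rule has_sum_cong_neutral[THEN iffD1, rotated -1]) auto
    have "?c \<in> ell2"
      using sq by (auto simp: ell2_def summable_on_def)
    from norm_synthesis_ge[OF assms this] show ?thesis
      unfolding synthesis_def infsumI[OF sq] infsumI[OF syn] .
  qed
  then show ?thesis
    unfolding riesz_basis_def
    using closure_span_eq_UNIV norm_finite_synthesis_le A_pos B_pos by blast
qed

section \<open>Shift invariance of the kernel and its infinite dimension\<close>

text \<open>Continuity lets S act termwise on the vanishing series, replacing \<open>f k\<close> by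
  \<open>f (k + 1)\<close>; reindexing moves this shift to the coefficients.\<close>

lemma synthesis_kernel_shift:
  assumes S: "bounded_clinear S" "\<And>k. S (f k) = f (k + 1)"
    and c: "c \<in> synthesis_kernel f"
  shows "(\<lambda>k. c (k - 1)) \<in> synthesis_kernel f"
proof -
  have S': "bounded_linear S" "\<And>a x. S (a *\<^sub>C x) = a *\<^sub>C S x"
    using S(1) by (auto simp: bounded_clinear_def)
  have c': "c \<in> ell2" "synthesis f c = 0"
    using c by (auto simp: synthesis_kernel_def)
  have "((\<lambda>k. S (c k *\<^sub>C f k)) has_sum S 0) UNIV"
    using has_sum_bounded_linear[OF S'(1) synthesis_has_sum[OF c'(1)]] c'(2) by simp
  then have "((\<lambda>k. c k *\<^sub>C f (k + 1)) has_sum 0) UNIV"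
    by (simp add: S' S(2) linear_0 bounded_linear.linear)
  then have "((\<lambda>k. c (k - 1) *\<^sub>C f (k - 1 + 1)) has_sum 0) UNIV"
    using has_sum_reindex_bij_betw[OF bij_int_pred, of "\<lambda>k. c k *\<^sub>C f (k + 1)"] by blast
  then show ?thesis
    using ell2_shift[OF c'(1)] by (simp add: synthesis_kernel_def synthesis_def infsumI)
qed

end

text \<open>For negative k, \<open>f k\<close> is the preimage of \<open>f (k + 1)\<close> under the
  bijection T of the span, so the two-sided definition reduces to one recursion.\<close>

lemma represented_by_step:
  assumes "represented_by f T"
  shows "T (f k) = f (k + 1)"
proof -
  define V where "V = complex_vector.span (range f)"
  have bij: "bij_betw T V V"
    and f: "\<And>k. f k = (if k \<ge> 0 then (T ^^ nat k) (f 0) else (inv_into V T ^^ nat (- k)) (f 0))"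
    using assms unfolding represented_by_def Let_def V_def by blast+
  have V: "f k \<in> V" for k
    unfolding V_def by (intro complex_vector.span_base) auto
  show ?thesis
  proof (cases "k \<ge> 0")
    case True
    then have "nat (k + 1) = Suc (nat k)"
      by simp
    then show ?thesis
      using True f[of k] f[of "k + 1"] by simp
  next
    case False
    then have n: "nat (- k) = Suc (nat (- (k + 1)))"
      by simp
    \<comment> \<open>At k = -1 the index k + 1 falls into the nonnegative branch, but there both
      branches are the zeroth power and give \<open>f 0\<close>.\<close>
    have "f (k + 1) = (inv_into V T ^^ nat (- (k + 1))) (f 0)"
      using False f[of "k + 1"] by (cases "k = - 1") auto
    then have "f k = inv_into V T (f (k + 1))"
      using False f[of k] n by simp
    then show ?thesis
      using bij_betw_inv_into_right[OF bij V[of "k + 1"]] by simp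
  qed
qed

theorem corollary2p5:
  fixes f :: "int \<Rightarrow> 'a::complex_hilbert_space" and T :: "'a \<Rightarrow> 'a"
  assumes "represented_by f T"
    and "overcomplete_frame f"
    and "extends_to_bounded (complex_vector.span (range f)) T"
  shows "infinite_dimensional (synthesis_kernel f)"
proof -
  obtain A B where "hilbert_frame f A B"
    using assms(2) unfolding overcomplete_frame_def is_frame_def hilbert_frame_def by blast
  then interpret hilbert_frame f A B .
  obtain S where S: "bounded_clinear S" "\<And>x. x \<in> complex_vector.span (range f) \<Longrightarrow> S x = T x"
    using assms(3) by (auto simp: extends_to_bounded_def)
  have step: "S (f k) = f (k + 1)" for k
    using S(2)[of "f k"] represented_by_step[OF assms(1)] complex_vector.span_base[of "f k"]
    by auto
  obtain c where c: "c \<in> synthesis_kernel f" "c \<noteq> (\<lambda>k. 0)"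
    using assms(2) riesz_basis_if_kernel_trivial unfolding overcomplete_frame_def by blast
  then have "c \<in> ell2"
    by (simp add: synthesis_kernel_def)
  let ?r = "\<lambda>(j::nat) k. c (k - int j)"
  have "?r j \<in> synthesis_kernel f" for j
  proof (induction j)
    case 0
    then show ?case using c(1) by simp
  next
    case (Suc j)
    then show ?case
      using synthesis_kernel_shift[OF S(1) step Suc.IH] by (simp add: algebra_simps)
  qed
  then have "range ?r \<subseteq> synthesis_kernel f"
    by blast
  \<comment> \<open>\<open>infinite_dimensional\<close> asks for an infinite basis, so the
    independent shifts are extended to a basis of the kernel.\<close>
  then obtain D where D: "range ?r \<subseteq> D" "D \<subseteq> synthesis_kernel f"
    "\<not> complex_seq.dependent D" "synthesis_kernel f \<subseteq> complex_seq.span D"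
    using complex_seq.maximal_independent_subset_extend
      independent_ell2_shifts[OF \<open>c \<in> ell2\<close> c(2)] by metis
  have "infinite D"
    using D(1) finite_subset range_inj_infinite[OF inj_ell2_shifts[OF \<open>c \<in> ell2\<close> c(2)]] by blast
  with D show ?thesis
    unfolding infinite_dimensional_def by blast
qed

end
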